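(* Assume $\|\partial_0 f\|<1$, and let $R\in(0,+\infty]$ and $D_a(0)$ be as defined in the context. Then $B(R)$ is an invariant set (i.e. $f(B(R))\subset B(R)$) included in the domain of attraction $D_a(0)$.
   Context: Let $\Omega\subset\mathbb{R}^n$ be a domain (open connected set) with $0\in\Omega$, and let $f:\Omega\to\Omega$ be an $\mathbb{R}$-analytic function with $f(0)=0$. Write $f^k$ for the $k$-th iterate of $f$ ($f^0=\mathrm{id}$), $\|\cdot\|$ for the Euclidean norm on $\mathbb{R}^n$ and for the induced operator norm on matrices, $\partial_0 f$ for the Jacobian matrix of $f$ at $0$, and $B(r)=\{x\in\mathbb{R}^n:\|x\|<r\}$ for $r>0$. The domain of attraction of $0$ is $D_a(0)=\{x\in\Omega: f^k(x)\to 0 \text{ as } k\to\infty\}$. Standing assumption: $\|\partial_0 f\|<1$; under this assumption there is $r>0$ with $B(r)\subset\Omega$ and $\|f(x)\|<\|x\|$ for all $x\in B(r)\setminus\{0\}$. Let $R>0$ be the largest number such that $B(R)\subset\Omega$ and $\|f(x)\|<\|x\|$ for any $x\in B(R)\setminus\{0\}$; if every $r>0$ has this property, then $R=+\infty$ and $B(R)=\Omega=\mathbb{R}^n$. *)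

theory Defs
  imports "HOL-Analysis.Analysis"
begin

text \<open>
  A map is real-analytic on \<open>S\<close> if around each point of \<open>S\<close> it is the sum of a convergent power
  series in several real variables. A multi-index is a function \<open>\<alpha> :: 'n \<Rightarrow> nat\<close>; the series is summed
  unconditionally over all multi-indices, which for finite-dimensional values is
  absolute convergence.
\<close>

definition monomial_at :: "real ^ 'n \<Rightarrow> ('n \<Rightarrow> nat) \<Rightarrow> real ^ 'n \<Rightarrow> real" where
  "monomial_at a \<alpha> x = (\<Prod>i\<in>UNIV. (x $ i - a $ i) ^ \<alpha> i)"

definition real_analytic_on :: "(real ^ 'n \<Rightarrow> real ^ 'm) \<Rightarrow> (real ^ 'n) set \<Rightarrow> bool" where
  "real_analytic_on f S \<longleftrightarrow>
     (\<forall>a\<in>S. \<exists>r>0. \<exists>c :: ('n \<Rightarrow> nat) \<Rightarrow> real ^ 'm.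
        \<forall>x\<in>ball a r. ((\<lambda>\<alpha>. monomial_at a \<alpha> x *\<^sub>R c \<alpha>) has_sum f x) UNIV)"

definition domain_of_attraction :: "(real ^ 'n) set \<Rightarrow> (real ^ 'n \<Rightarrow> real ^ 'n) \<Rightarrow> (real ^ 'n) set" where
  "domain_of_attraction \<Omega> f = {x \<in> \<Omega>. (\<lambda>k. (f ^^ k) x) \<longlonglongrightarrow> 0}"

definition norm_decreasing_radius :: "(real ^ 'n) set \<Rightarrow> (real ^ 'n \<Rightarrow> real ^ 'n) \<Rightarrow> real \<Rightarrow> bool" where
  "norm_decreasing_radius \<Omega> f r \<longleftrightarrow>
     0 < r \<and> ball 0 r \<subseteq> \<Omega> \<and> (\<forall>x\<in>ball 0 r - {0}. norm (f x) < norm x)"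

text \<open>
  The number \<open>R\<close>. \<open>GREATEST\<close> denotes the maximum of the admissible radii, so it is only
  meaningful when that maximum exists; when the operator norm of the Jacobian matrix at 0 is less
  than 1, it does unless every radius is admissible.
\<close>

definition max_decreasing_radius :: "(real ^ 'n) set \<Rightarrow> (real ^ 'n \<Rightarrow> real ^ 'n) \<Rightarrow> ereal" where
  "max_decreasing_radius \<Omega> f =
     (if \<forall>r>0. norm_decreasing_radius \<Omega> f r then \<infinity>
      else ereal (GREATEST r. norm_decreasing_radius \<Omega> f r))"

end

theory Submission
  imports Defs
begin

text \<open>
  Two facts about the map are needed: it is continuous on \<open>\<Omega>\<close>, and it is differentiable at \<open>0\<close>,
  so that the hypothesis on the Jacobian matrix really controls \<open>f\<close> near \<open>0\<close>. Both follow from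
  differentiability of the sum of a power series at its centre: the terms of degree at least two
  are dominated, at distance \<open>u \<le> t\<close> from the centre, by \<open>(u/t)\<^sup>2\<close> times the summable
  terms of the series of norms at polyradius \<open>t\<close>, hence contribute \<open>O(u\<^sup>2)\<close>
  (\<open>real_analytic_imp_differentiable\<close>).

  Since the derivative at \<open>0\<close> has operator norm below one, \<open>f\<close> shrinks norms on some small ball,
  so an admissible radius (one satisfying \<open>norm_decreasing_radius\<close>) exists. Admissible radii are closed under decreasing and under bounded
  suprema, so if some radius is not admissible, a largest admissible one exists
  (\<open>max_decreasing_radius_finite\<close>). Hence every point of \<open>B(R)\<close> lies in a ball of real
  admissible radius, and \<open>f\<close> does not increase its norm; this is invariance.

  For attraction, the norms along an orbit decrease to some \<open>L\<close>. The orbit stays in a compact ball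
  contained in \<open>B(R)\<close>, so it has a limit point \<open>y\<close>, with \<open>\<parallel>y\<parallel> = L\<close>, and by continuity also
  \<open>\<parallel>f y\<parallel> = L\<close>. As \<open>f\<close> strictly shrinks the norm of nonzero points, \<open>y = 0\<close>
  and therefore \<open>L = 0\<close>.
\<close>

section \<open>Differentiability of power series in several variables\<close>

lemma monomial_at_shift: "monomial_at a \<alpha> x = monomial_at 0 \<alpha> (x - a)"
  by (simp add: monomial_at_def)

lemma monomial_at_const: "monomial_at a \<alpha> (a + (\<chi> i. t)) = t ^ (\<Sum>i\<in>UNIV. \<alpha> i)"
  by (simp add: monomial_at_def power_sum)

lemma abs_monomial_at_le: "\<bar>monomial_at a \<alpha> x\<bar> \<le> norm (x - a) ^ (\<Sum>i\<in>UNIV. \<alpha> i)"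
proof -
  have "\<bar>monomial_at a \<alpha> x\<bar> = (\<Prod>i\<in>UNIV. \<bar>(x - a) $ i\<bar> ^ \<alpha> i)"
    by (simp add: monomial_at_def abs_prod power_abs)
  also have "\<dots> \<le> (\<Prod>i\<in>UNIV. norm (x - a) ^ \<alpha> i)"
    by (intro prod_mono conjI power_mono component_le_norm_cart) auto
  finally show ?thesis by (simp add: power_sum)
qed

lemma sum_eq_1_imp_indicator:
  fixes \<alpha> :: "'n::finite \<Rightarrow> nat"
  assumes "(\<Sum>i\<in>UNIV. \<alpha> i) = 1"
  shows "\<exists>i. \<alpha> = (\<lambda>j. if j = i then 1 else 0)"
proof -
  obtain i where "\<alpha> i = 1" "\<forall>j. i \<noteq> j \<longrightarrow> \<alpha> j = 0"
    using assms by (subst (asm) sum_eq_1_iff) auto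
  then show ?thesis by (intro exI[of _ i]) auto
qed

lemma finite_multi_indices_degree_1: "finite {\<alpha> :: 'n::finite \<Rightarrow> nat. (\<Sum>i\<in>UNIV. \<alpha> i) = 1}"
  by (rule finite_surj[where A = UNIV and f = "\<lambda>i j. if j = i then 1 else 0"])
     (use sum_eq_1_imp_indicator in fastforce)+

lemma bounded_linear_monomial_degree_1:
  fixes \<alpha> :: "'n::finite \<Rightarrow> nat"
  assumes "(\<Sum>i\<in>UNIV. \<alpha> i) = 1"
  shows "bounded_linear (monomial_at 0 \<alpha>)"
proof -
  obtain i where i: "\<alpha> = (\<lambda>j. if j = i then 1 else 0)"
    using sum_eq_1_imp_indicator[OF assms] by blast
  have "monomial_at 0 \<alpha> = (\<lambda>h. h $ i)"
    unfolding monomial_at_def i by (intro ext) (simp add: if_distrib cong: if_cong)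
  then show ?thesis by (simp add: bounded_linear_vec_nth)
qed

lemma summable_on_imp_abs_summable_on_euclidean:
  fixes g :: "'a \<Rightarrow> 'b::euclidean_space"
  assumes "g summable_on A"
  shows "(\<lambda>x. norm (g x)) summable_on A"
proof (rule Infinite_Sum.abs_summable_on_comparison_test')
  have coord: "(\<lambda>x. \<bar>g x \<bullet> b\<bar>) summable_on A" for b
  proof -
    have "(\<lambda>x. g x \<bullet> b) summable_on A"
      by (rule summable_on_bounded_linear[OF bounded_linear_inner_left assms])
    then show ?thesis
      by (subst (asm) summable_on_iff_abs_summable_on_real) simp
  qed
  have "(\<lambda>x. \<Sum>b\<in>B. \<bar>g x \<bullet> b\<bar>) summable_on A" if "finite B" for B
    using that by (induction B) (simp_all add: summable_on_add coord)
  then show "(\<lambda>x. \<Sum>b\<in>Basis. \<bar>g x \<bullet> b\<bar>) summable_on A"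
    by simp
qed (rule norm_le_l1)

text \<open>
  The comparison constant comes from absolute convergence at the corner \<open>a + (t, \<dots>, t)\<close>, where
  every monomial of degree \<open>d\<close> takes the value \<open>t\<^sup>d\<close>, the largest possible on the cube of
  half-width \<open>t\<close>.
\<close>

lemma power_series_has_derivative_at_centre:
  fixes f :: "real ^ 'n \<Rightarrow> real ^ 'm" and c :: "('n \<Rightarrow> nat) \<Rightarrow> real ^ 'm"
  assumes "r > 0"
    and series: "\<And>x. x \<in> ball a r \<Longrightarrow> ((\<lambda>\<alpha>. monomial_at a \<alpha> x *\<^sub>R c \<alpha>) has_sum f x) UNIV"
  shows "(f has_derivative (\<lambda>h. \<Sum>\<alpha> | (\<Sum>i\<in>UNIV. \<alpha> i) = 1. monomial_at 0 \<alpha> h *\<^sub>R c \<alpha>)) (at a)"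
proof -
  define deg :: "('n \<Rightarrow> nat) \<Rightarrow> nat" where "deg \<alpha> = (\<Sum>i\<in>UNIV. \<alpha> i)" for \<alpha>
  define D where "D = {\<alpha>. deg \<alpha> = 1}"
  define H where "H = {\<alpha>. 2 \<le> deg \<alpha>}"
  define lin where "lin h = (\<Sum>\<alpha>\<in>D. monomial_at 0 \<alpha> h *\<^sub>R c \<alpha>)" for h
  have finD: "finite D"
    unfolding D_def deg_def by (rule finite_multi_indices_degree_1)
  have deg_0: "deg \<alpha> = 0 \<longleftrightarrow> \<alpha> = (\<lambda>_. 0)" for \<alpha>
    by (auto simp: deg_def)
  have "(\<lambda>_. 0) \<notin> D"
    using deg_0[of "\<lambda>_. 0"] by (simp add: D_def)
  have H_eq: "H = UNIV - insert (\<lambda>_. 0) D"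
  proof -
    have "2 \<le> deg \<alpha> \<longleftrightarrow> deg \<alpha> \<noteq> 0 \<and> deg \<alpha> \<noteq> 1" for \<alpha>
      by linarith
    then show ?thesis
      unfolding deg_0 H_def D_def by blast
  qed
  define p :: "real ^ 'n" where "p = (\<chi> i. 1)"
  have "norm p > 0"
    by (simp add: p_def vec_eq_iff)
  define t where "t = r / (2 * norm p)"
  have "t > 0"
    using \<open>r > 0\<close> \<open>norm p > 0\<close> by (simp add: t_def)
  have corner: "a + (\<chi> i. t) \<in> ball a r"
  proof -
    have "(\<chi> i. t) = t *\<^sub>R p"
      by (simp add: p_def vec_eq_iff)
    then have "norm (\<chi> i. t :: real ^ 'n) = r / 2"
      using \<open>r > 0\<close> \<open>norm p > 0\<close> by (simp add: t_def)
    then show ?thesis using \<open>r > 0\<close> by (simp add: dist_norm)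
  qed
  have "(\<lambda>\<alpha>. norm (t ^ deg \<alpha> *\<^sub>R c \<alpha>)) summable_on UNIV"
    using series[OF corner] unfolding monomial_at_const deg_def
    by (intro summable_on_imp_abs_summable_on_euclidean) (rule has_sum_imp_summable)
  then have "(\<lambda>\<alpha>. norm (t ^ deg \<alpha> *\<^sub>R c \<alpha>)) summable_on H"
    by (rule summable_on_subset_banach) simp
  then obtain M where M: "((\<lambda>\<alpha>. norm (t ^ deg \<alpha> *\<^sub>R c \<alpha>)) has_sum M) H"
    by (auto simp: summable_on_def)
  have decompose:
      "((\<lambda>\<alpha>. monomial_at a \<alpha> x *\<^sub>R c \<alpha>) has_sum (f x - (c (\<lambda>_. 0) + lin (x - a)))) H"
    if "x \<in> ball a r" for x
  proof -
    have "((\<lambda>\<alpha>. monomial_at a \<alpha> x *\<^sub>R c \<alpha>) has_sum (c (\<lambda>_. 0) + lin (x - a)))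
        (insert (\<lambda>_. 0) D)"
      using finD \<open>(\<lambda>_. 0) \<notin> D\<close>
      by (intro has_sum_finiteI)
         (simp_all add: lin_def monomial_at_shift[of a _ x], simp add: monomial_at_def)
    then show ?thesis
      unfolding H_eq by (intro has_sum_Diff series that) auto
  qed
  have linear_lin: "bounded_linear lin"
    unfolding lin_def
    by (intro bounded_linear_sum bounded_linear_scaleR_const bounded_linear_monomial_degree_1)
       (simp add: D_def deg_def)
  then have "lin 0 = 0"
    by (rule linear_0[OF bounded_linear.linear])
  have centre: "f a = c (\<lambda>_. 0)"
  proof -
    have "monomial_at a \<alpha> a = 0" if "\<alpha> \<in> H" for \<alpha>
      using abs_monomial_at_le[of a \<alpha> a] that
      by (auto simp: H_def deg_def[symmetric] power_0_left split: if_splits)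
    then have "((\<lambda>\<alpha>. monomial_at a \<alpha> a *\<^sub>R c \<alpha>) has_sum 0) H"
      by (intro has_sum_0) simp
    moreover have "a \<in> ball a r" using \<open>r > 0\<close> by simp
    ultimately show ?thesis
      using has_sum_unique[OF decompose] \<open>lin 0 = 0\<close> by fastforce
  qed
  have remainder: "norm (f x - f a - lin (x - a)) \<le> (norm (x - a) / t)\<^sup>2 * M"
    if "norm (x - a) < r" "norm (x - a) \<le> t" for x
  proof (rule norm_infsum_le)
    have "x \<in> ball a r"
      using that by (simp add: dist_norm norm_minus_commute)
    from decompose[OF this]
    show "((\<lambda>\<alpha>. monomial_at a \<alpha> x *\<^sub>R c \<alpha>) has_sum (f x - f a - lin (x - a))) H"
      by (simp add: centre algebra_simps)
    show "((\<lambda>\<alpha>. (norm (x - a) / t)\<^sup>2 * norm (t ^ deg \<alpha> *\<^sub>R c \<alpha>)) has_sum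
        ((norm (x - a) / t)\<^sup>2 * M)) H"
      by (rule has_sum_cmult_right[OF M])
    fix \<alpha> assume "\<alpha> \<in> H"
    have "\<bar>monomial_at a \<alpha> x\<bar> \<le> norm (x - a) ^ deg \<alpha>"
      unfolding deg_def by (rule abs_monomial_at_le)
    also have "\<dots> = (norm (x - a) / t) ^ deg \<alpha> * t ^ deg \<alpha>"
      using \<open>t > 0\<close> by (simp add: power_divide)
    also have "\<dots> \<le> (norm (x - a) / t)\<^sup>2 * t ^ deg \<alpha>"
      using \<open>t > 0\<close> that \<open>\<alpha> \<in> H\<close>
      by (intro mult_right_mono power_decreasing) (auto simp: H_def)
    finally show "norm (monomial_at a \<alpha> x *\<^sub>R c \<alpha>)
        \<le> (norm (x - a) / t)\<^sup>2 * norm (t ^ deg \<alpha> *\<^sub>R c \<alpha>)"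
      using \<open>t > 0\<close> by (simp add: mult_right_mono mult.assoc[symmetric])
  qed
  have "(f has_derivative lin) (at a)"
  proof (rule has_derivativeI_sandwich[where e = "min r t"])
    show "((\<lambda>x. norm (x - a) * (M / t\<^sup>2)) \<longlongrightarrow> 0) (at a)"
      using \<open>t > 0\<close> by (auto intro!: tendsto_eq_intros)
    fix x assume "x \<noteq> a" "dist x a < min r t"
    then have "norm (f x - f a - lin (x - a)) \<le> (norm (x - a) / t)\<^sup>2 * M"
      by (intro remainder) (simp_all add: dist_norm)
    then show "norm (f x - f a - lin (x - a)) / norm (x - a) \<le> norm (x - a) * (M / t\<^sup>2)"
      using \<open>x \<noteq> a\<close> by (simp add: pos_divide_le_eq power_divide power2_eq_square mult_ac)
  qed (use \<open>r > 0\<close> \<open>t > 0\<close> linear_lin in auto)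
  then show ?thesis
    unfolding lin_def D_def deg_def .
qed

lemma real_analytic_imp_differentiable:
  assumes "real_analytic_on f S" and "a \<in> S"
  shows "f differentiable (at a)"
  using assms power_series_has_derivative_at_centre[of _ a _ f]
  unfolding real_analytic_on_def differentiable_def by blast

section \<open>The largest norm-decreasing radius\<close>

lemma norm_decreasing_radius_exists:
  fixes f :: "real ^ 'n \<Rightarrow> real ^ 'n"
  assumes "open \<Omega>" "0 \<in> \<Omega>" "f differentiable (at 0)" "f 0 = 0"
    and "onorm (\<lambda>x. jacobian f (at 0) *v x) < 1"
  shows "\<exists>r. norm_decreasing_radius \<Omega> f r"
proof -
  define T where "T = (\<lambda>x. jacobian f (at 0) *v x)"
  define e where "e = (1 - onorm T) / 2"
  have "e > 0" and e: "e + onorm T < 1"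
    using assms(5) by (simp_all add: e_def T_def field_simps)
  have der: "(f has_derivative T) (at 0)"
    using assms(3) by (simp add: jacobian_works T_def)
  then obtain d where "d > 0" and d: "\<And>x. norm x < d \<Longrightarrow> norm (f x - T x) \<le> e * norm x"
    using \<open>e > 0\<close> \<open>f 0 = 0\<close> unfolding has_derivative_at_alt by fastforce
  obtain \<delta> where "\<delta> > 0" "ball 0 \<delta> \<subseteq> \<Omega>"
    using assms(1,2) openE by blast
  have "norm (f x) < norm x" if "norm x < d" "x \<noteq> 0" for x
  proof -
    have "norm (f x) \<le> norm (f x - T x) + norm (T x)"
      using norm_triangle_ineq[of "f x - T x" "T x"] by simp
    also have "\<dots> \<le> e * norm x + onorm T * norm x"
      using d[OF that(1)] onorm[OF has_derivative_bounded_linear[OF der]] by (rule add_mono)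
    also have "\<dots> = (e + onorm T) * norm x"
      by (simp add: algebra_simps)
    also have "\<dots> < norm x"
      using e \<open>x \<noteq> 0\<close> by simp
    finally show ?thesis .
  qed
  then have "norm_decreasing_radius \<Omega> f (min d \<delta>)"
    using \<open>d > 0\<close> \<open>\<delta> > 0\<close> \<open>ball 0 \<delta> \<subseteq> \<Omega>\<close> by (auto simp: norm_decreasing_radius_def)
  then show ?thesis ..
qed

lemma norm_decreasing_radius_mono:
  assumes "norm_decreasing_radius \<Omega> f r" "0 < s" "s \<le> r"
  shows "norm_decreasing_radius \<Omega> f s"
  using assms subset_ball[of s r 0] unfolding norm_decreasing_radius_def by blast

text \<open>
  An open ball of radius \<open>Sup A\<close> is the union of the balls with radii in \<open>A\<close>, so the supremum of
  the admissible radii is itself admissible: this is what makes \<open>GREATEST\<close> meaningful.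
\<close>

lemma max_decreasing_radius_finite:
  assumes "norm_decreasing_radius \<Omega> f r\<^sub>0"
    and "\<not> (\<forall>r>0. norm_decreasing_radius \<Omega> f r)"
  obtains r where "norm_decreasing_radius \<Omega> f r" "max_decreasing_radius \<Omega> f = ereal r"
proof -
  define A where "A = {r. norm_decreasing_radius \<Omega> f r}"
  obtain b where "b > 0" "\<not> norm_decreasing_radius \<Omega> f b"
    using assms(2) by blast
  then have "r \<le> b" if "r \<in> A" for r
    using norm_decreasing_radius_mono[of \<Omega> f r b] that by (force simp: A_def)
  then have bdd: "bdd_above A"
    by (rule bdd_aboveI)
  have "r\<^sub>0 \<in> A"
    using assms(1) by (simp add: A_def)
  have Sup_in: "norm_decreasing_radius \<Omega> f (Sup A)"
  proof -
    have "0 < r\<^sub>0"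
      using assms(1) by (simp add: norm_decreasing_radius_def)
    then have "0 < Sup A"
      using cSup_upper[OF \<open>r\<^sub>0 \<in> A\<close> bdd] by simp
    moreover have "x \<in> \<Omega> \<and> (x \<noteq> 0 \<longrightarrow> norm (f x) < norm x)" if "norm x < Sup A" for x
    proof -
      obtain r where "r \<in> A" "norm x < r"
        using \<open>norm x < Sup A\<close> less_cSup_iff[of A "norm x"] \<open>r\<^sub>0 \<in> A\<close> bdd by blast
      then show ?thesis by (auto simp: A_def norm_decreasing_radius_def subset_iff)
    qed
    ultimately show ?thesis
      by (auto simp: norm_decreasing_radius_def)
  qed
  moreover have "(GREATEST r. norm_decreasing_radius \<Omega> f r) = Sup A"
    using Sup_in bdd by (intro Greatest_equality cSup_upper) (simp_all add: A_def)
  ultimately show thesis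
    using that assms(2) by (auto simp: max_decreasing_radius_def)
qed

text \<open>
  This treats finite and infinite \<open>R\<close> alike: afterwards only balls of real radius occur.
\<close>

lemma in_max_ball_imp_in_decreasing_ball:
  assumes "\<exists>r. norm_decreasing_radius \<Omega> f r"
    and "x \<in> eball 0 (max_decreasing_radius \<Omega> f)"
  obtains r where "norm_decreasing_radius \<Omega> f r" "norm x < r"
proof (cases "\<forall>r>0. norm_decreasing_radius \<Omega> f r")
  case True
  then have "norm_decreasing_radius \<Omega> f (norm x + 1)"
    by (simp add: add_nonneg_pos)
  then show thesis
    using that by simp
next
  case False
  then obtain r where "norm_decreasing_radius \<Omega> f r" "max_decreasing_radius \<Omega> f = ereal r"
    using assms(1) max_decreasing_radius_finite by blast
  then show thesis
    using that assms(2) by simp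
qed

section \<open>Convergence of norm-decreasing orbits\<close>

lemma norm_image_le_of_decreasing:
  assumes "norm_decreasing_radius \<Omega> f r" "f 0 = 0" "norm x < r"
  shows "norm (f x) \<le> norm x"
  using assms by (cases "x = 0") (auto simp: norm_decreasing_radius_def less_imp_le)

text \<open>
  Strict decrease at each point does not give a uniform contraction factor, so the orbit norms
  could a priori stall at a positive value. Continuity excludes this: a limit point of the orbit
  would be a nonzero point whose norm \<open>f\<close> preserves.
\<close>

lemma norm_decreasing_orbit_tendsto_0:
  fixes f :: "real ^ 'n \<Rightarrow> real ^ 'n"
  assumes r: "norm_decreasing_radius \<Omega> f r" and "f 0 = 0" and cont: "continuous_on (ball 0 r) f"
    and "norm x < r"
  shows "(\<lambda>k. (f ^^ k) x) \<longlonglongrightarrow> 0"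
proof -
  define u where "u k = (f ^^ k) x" for k
  have u_Suc: "u (Suc k) = f (u k)" for k
    by (simp add: u_def)
  have u_le: "norm (u k) \<le> norm x" for k
  proof (induction k)
    case (Suc k)
    then show ?case
      using norm_image_le_of_decreasing[OF r \<open>f 0 = 0\<close>, of "u k"] \<open>norm x < r\<close>
      by (simp add: u_Suc)
  qed (simp add: u_def)
  have "decseq (\<lambda>k. norm (u k))"
    using u_le \<open>norm x < r\<close> norm_image_le_of_decreasing[OF r \<open>f 0 = 0\<close>]
    by (intro decseq_SucI) (metis u_Suc le_less_trans)
  then obtain L where L: "(\<lambda>k. norm (u k)) \<longlonglongrightarrow> L"
    using decseq_convergent[of "\<lambda>k. norm (u k)" 0] by auto
  obtain y s where y: "y \<in> cball 0 (norm x)" and "strict_mono s" and lim: "(u \<circ> s) \<longlonglongrightarrow> y"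
    using compact_cball[of 0 "norm x"] u_le unfolding compact_def by (metis mem_cball_0)
  have "norm y < r"
    using y \<open>norm x < r\<close> by simp
  have "(\<lambda>k. norm (u (s k))) \<longlonglongrightarrow> L"
    using LIMSEQ_subseq_LIMSEQ[OF L \<open>strict_mono s\<close>] by (simp add: o_def)
  moreover have "(\<lambda>k. norm (u (s k))) \<longlonglongrightarrow> norm y"
    using tendsto_norm[OF lim] by (simp add: o_def)
  ultimately have "norm y = L"
    using LIMSEQ_unique by blast
  have "isCont f y"
    using cont \<open>norm y < r\<close> by (simp add: continuous_on_eq_continuous_at)
  then have "(\<lambda>k. f (u (s k))) \<longlonglongrightarrow> f y"
    using isCont_tendsto_compose[OF _ lim] by (simp add: o_def)
  then have "(\<lambda>k. norm (u (Suc (s k)))) \<longlonglongrightarrow> norm (f y)"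
    unfolding u_Suc by (rule tendsto_norm)
  moreover have "(\<lambda>k. norm (u (Suc (s k)))) \<longlonglongrightarrow> L"
    using LIMSEQ_subseq_LIMSEQ[OF LIMSEQ_Suc[OF L] \<open>strict_mono s\<close>] by (simp add: o_def)
  ultimately have "norm (f y) = norm y"
    using LIMSEQ_unique \<open>norm y = L\<close> by blast
  then have "y = 0"
    using r \<open>norm y < r\<close> by (force simp: norm_decreasing_radius_def)
  then show ?thesis
    using L \<open>norm y = L\<close> by (simp add: u_def tendsto_norm_zero_iff)
qed

theorem theorem2p4:
  fixes \<Omega> :: "(real ^ 'n) set" and f :: "real ^ 'n \<Rightarrow> real ^ 'n" and R :: ereal
  assumes "open \<Omega>" and "connected \<Omega>" and "0 \<in> \<Omega>"
    and "f ` \<Omega> \<subseteq> \<Omega>" and "real_analytic_on f \<Omega>" and "f 0 = 0"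
    and "onorm (\<lambda>x. jacobian f (at 0) *v x) < 1"
  defines "R \<equiv> max_decreasing_radius \<Omega> f"
  shows "f ` eball 0 R \<subseteq> eball 0 R \<and> eball 0 R \<subseteq> domain_of_attraction \<Omega> f"
proof -
  have diff: "f differentiable (at x)" if "x \<in> \<Omega>" for x
    using real_analytic_imp_differentiable[OF assms(5) that] .
  have cont: "continuous_on \<Omega> f"
    by (intro continuous_at_imp_continuous_on ballI differentiable_imp_continuous_within diff)
  have ex: "\<exists>r. norm_decreasing_radius \<Omega> f r"
    using norm_decreasing_radius_exists[OF assms(1,3) diff[OF assms(3)] assms(6,7)] .
  have "f x \<in> eball 0 R \<and> x \<in> domain_of_attraction \<Omega> f" if x: "x \<in> eball 0 R" for x
  proof -
    obtain r where r: "norm_decreasing_radius \<Omega> f r" and "norm x < r"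
      using in_max_ball_imp_in_decreasing_ball[OF ex] x unfolding R_def by blast
    have "norm (f x) \<le> norm x"
      using norm_image_le_of_decreasing[OF r \<open>f 0 = 0\<close> \<open>norm x < r\<close>] .
    then have "ereal (norm (f x)) < R"
      using x by (auto intro: le_less_trans[of _ "ereal (norm x)"])
    moreover have sub: "ball 0 r \<subseteq> \<Omega>"
      using r by (simp add: norm_decreasing_radius_def)
    moreover have "(\<lambda>k. (f ^^ k) x) \<longlonglongrightarrow> 0"
      using r \<open>f 0 = 0\<close> continuous_on_subset[OF cont sub] \<open>norm x < r\<close>
      by (rule norm_decreasing_orbit_tendsto_0)
    ultimately show ?thesis
      using \<open>norm x < r\<close> by (auto simp: domain_of_attraction_def)
  qed
  then show ?thesis by blast
qed

end
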